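(* If $\theta$ is a normal classical integer of value $n$, then $\theta\hookrightarrow\underline{n}$, where $\underline{n}=\lambda x\lambda f(f)^n x$.
   Context: **$\lambda\mu$-terms.** There are two disjoint alphabets of variables: $\lambda$-variables $x,y,z,\dots$ and $\mu$-variables $\alpha,\beta,\gamma,\dots$. Terms are generated by: a $\lambda$-variable $x$; $\lambda x\,u$; application $(u)v$; and $\mu\alpha[\beta]t$ ($\alpha,\beta$ $\mu$-variables, possibly equal, $t$ a term). $\lambda x$ binds $x$ and $\mu\alpha$ binds $\alpha$. An expression $[\alpha]t$ is called a named term. Terms are considered up to renaming of bound variables; in each term the free and bound variables are assumed distinct and each bound variable is bound only once. Below, in $\mu\alpha u$, $u$ denotes a named term. $(f)^n x$ denotes $(f)(f)\cdots(f)x$ ($n$ times). **Reduction.** Computation rules: $(C_1)$ $(\lambda x u)v\to u[v/x]$; $(C_2)$ $(\mu\alpha u)v\to\mu\alpha\,u[v/{*}\alpha]$, where $u[v/{*}\alpha]$ is obtained by inductively replacing each subterm $[\alpha]w$ of $u$ by $[\alpha](w)v$. Simplification rules: $(S_1)$ $[\alpha]\mu\beta u\to u[\alpha/\beta]$; $(S_2)$ $\mu\alpha[\alpha]u\to u$ if $\alpha$ is not free in $u$; $(S_3)$ $\mu\alpha u\to\lambda x\mu\alpha\,u[x/{*}\alpha]$ ($x$ fresh) if $u$ contains a subterm of the form $[\alpha]\lambda y w$. A term is normal if none of the rules $C_1,C_2,S_1,S_2,S_3$ applies to any of its subterms (the rule $(N)$ below is not taken into account in the definition of normal). **Cleaning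 rule and $\hookrightarrow$.** $(N)$ $(u)\mu\alpha v\to\mu\alpha\,v[u/{**}\alpha]$, where $v[u/{**}\alpha]$ is obtained by inductively replacing each subterm $[\alpha]w$ of $v$ by $[\alpha](u)w$. Write $u\hookrightarrow v$ if $v$ is obtained from $u$ by a finite (possibly empty) sequence of steps, each step consisting of at most one application of $(N)$ to some subterm followed by applying the simplification rules $(S_1),(S_2),(S_3)$ as long as possible (the simplification rules are strongly normalizing). **Types.** Types are formulas of second-order predicate logic built with $\bot,\to,\forall$ (first-order and second-order quantifiers), in a language containing a constant $0$ and a unary function symbol $s$. $F_1,\dots,F_n\to G$ denotes $F_1\to(F_2\to\cdots(F_n\to G))$. Fix a set $E$ of equations between first-order terms; $\vdash_E u=v$ means $u=v$ is a consequence of $E$. $E$ is assumed adequate for integers: $\not\vdash_E s(a)=0$, and $\vdash_E s(a)=s(b)$ implies $\vdash_E a=b$. Judgments have the form $\Gamma\vdash t:A,\Delta$, where $\Gamma=x_1:A_1,\dots,x_n:A_n$ and $\Delta=\alpha_1:B_1,\dots,\alpha_m:B_m$ are regarded as sets (so contraction is implicit) and distinct formulas do not carry the same label. Rules: (1) $\Gamma\vdash x_i:A_i,\Delta$. (2) From $\Gamma,x:A\vdash t:B,\Delta$ infer $\Gamma\vdash\lambda x t:A\to B,\Delta$. (3) From $\Gamma\vdash u:A\to B,\Delta$ and $\Gamma\vdash v:A,\Delta$ infer $\Gamma\vdash(u)v:B,\Delta$. (4) From $\Gamma\vdash t:A,\Delta$ infer $\Gamma\vdash t:\forall xA,\Delta$,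 if $x$ is not free in $\Gamma,\Delta$. (5) From $\Gamma\vdash t:\forall xA,\Delta$ infer $\Gamma\vdash t:A[u/x],\Delta$, $u$ a first-order term. (6) From $\Gamma\vdash t:A,\Delta$ infer $\Gamma\vdash t:\forall XA,\Delta$, if $X$ is not free in $\Gamma,\Delta$. (7) From $\Gamma\vdash t:\forall XA,\Delta$ infer $\Gamma\vdash t:A[G/X],\Delta$, $G$ a formula. (8) From $\Gamma\vdash t:A[u/x],\Delta$ infer $\Gamma\vdash t:A[v/x],\Delta$, if $\vdash_E u=v$. (9) From $\Gamma\vdash t:A,\beta:B,\Delta$ infer $\Gamma\vdash\mu\beta[\alpha]t:B,\alpha:A,\Delta$ if $\alpha\neq\beta$, and $\Gamma\vdash\mu\alpha[\alpha]t:B,\Delta$ if $\alpha=\beta$ (in which case $A=B$). Weakening is included in rules (2) and (9): the discharged hypothesis $x:A$, respectively $\beta:B$, need not actually occur in the premise. **Classical integers.** $N[x]=\forall X\{X(0),\forall y(X(y)\to X(sy))\to X(x)\}$ with $X$ a unary relation variable. A classical integer of value $n$ is a closed $\lambda\mu$-term $\theta$ such that $\vdash\theta:N[s^n(0)]$. *)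

theory Defs
  imports Main
begin

section \<open>Terms\<close>

text \<open>
  Terms up to renaming of bound variables, as de Bruijn terms with two independent families of
  indices: \<open>Lam\<close> binds \<open>\<lambda>\<close>-index 0 and \<open>Mu\<close> binds \<open>\<mu>\<close>-index 0. \<open>Named \<beta> t\<close> is the named term
  \<open>[\<beta>]t\<close>, so \<open>Mu (Named 0 t)\<close> is \<open>\<mu>\<alpha>[\<alpha>]t\<close>, while \<open>Mu (Named (Suc \<beta>) t)\<close> is \<open>\<mu>\<alpha>[\<beta>]t\<close> with
  \<open>\<beta> \<noteq> \<alpha>\<close> a \<open>\<mu>\<close>-variable of the surrounding scope.
\<close>

datatype trm = Var nat | Lam trm | App trm trm | Mu cmd
  and cmd = Named nat trm

primrec fv_lam :: "trm \<Rightarrow> nat set" and fv_lam_c :: "cmd \<Rightarrow> nat set" where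
  "fv_lam (Var i) = {i}"
| "fv_lam (Lam t) = {i. Suc i \<in> fv_lam t}"
| "fv_lam (App t u) = fv_lam t \<union> fv_lam u"
| "fv_lam (Mu c) = fv_lam_c c"
| "fv_lam_c (Named \<beta> t) = fv_lam t"

primrec fv_mu :: "trm \<Rightarrow> nat set" and fv_mu_c :: "cmd \<Rightarrow> nat set" where
  "fv_mu (Var i) = {}"
| "fv_mu (Lam t) = fv_mu t"
| "fv_mu (App t u) = fv_mu t \<union> fv_mu u"
| "fv_mu (Mu c) = {\<alpha>. Suc \<alpha> \<in> fv_mu_c c}"
| "fv_mu_c (Named \<beta> t) = insert \<beta> (fv_mu t)"

definition closed :: "trm \<Rightarrow> bool" where
  "closed t \<longleftrightarrow> fv_lam t = {} \<and> fv_mu t = {}"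

primrec up :: "(nat \<Rightarrow> nat) \<Rightarrow> nat \<Rightarrow> nat" where
  "up r 0 = 0"
| "up r (Suc i) = Suc (r i)"

text \<open>\<open>ren r m\<close> renames free \<open>\<lambda>\<close>-variables by \<open>r\<close> and free \<open>\<mu>\<close>-variables by \<open>m\<close>.\<close>

primrec ren :: "(nat \<Rightarrow> nat) \<Rightarrow> (nat \<Rightarrow> nat) \<Rightarrow> trm \<Rightarrow> trm"
  and ren_c :: "(nat \<Rightarrow> nat) \<Rightarrow> (nat \<Rightarrow> nat) \<Rightarrow> cmd \<Rightarrow> cmd" where
  "ren r m (Var i) = Var (r i)"
| "ren r m (Lam t) = Lam (ren (up r) m t)"
| "ren r m (App t u) = App (ren r m t) (ren r m u)"
| "ren r m (Mu c) = Mu (ren_c r (up m) c)"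
| "ren_c r m (Named \<beta> t) = Named (m \<beta>) (ren r m t)"

abbreviation lift_lam :: "trm \<Rightarrow> trm" where "lift_lam \<equiv> ren Suc id"
abbreviation lift_mu :: "trm \<Rightarrow> trm" where "lift_mu \<equiv> ren id Suc"

primrec up_sub :: "(nat \<Rightarrow> trm) \<Rightarrow> nat \<Rightarrow> trm" where
  "up_sub \<sigma> 0 = Var 0"
| "up_sub \<sigma> (Suc i) = lift_lam (\<sigma> i)"

primrec sub :: "(nat \<Rightarrow> trm) \<Rightarrow> trm \<Rightarrow> trm"
  and sub_c :: "(nat \<Rightarrow> trm) \<Rightarrow> cmd \<Rightarrow> cmd" where
  "sub \<sigma> (Var i) = \<sigma> i"
| "sub \<sigma> (Lam t) = Lam (sub (up_sub \<sigma>) t)"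
| "sub \<sigma> (App t u) = App (sub \<sigma> t) (sub \<sigma> u)"
| "sub \<sigma> (Mu c) = Mu (sub_c (\<lambda>i. lift_mu (\<sigma> i)) c)"
| "sub_c \<sigma> (Named \<beta> t) = Named \<beta> (sub \<sigma> t)"

text \<open>\<open>sub_right \<alpha> v u\<close> is \<open>u[v/*\<alpha>]\<close> and \<open>sub_left \<alpha> v u\<close> is \<open>u[v/**\<alpha>]\<close>.\<close>

primrec sub_right :: "nat \<Rightarrow> trm \<Rightarrow> trm \<Rightarrow> trm"
  and sub_right_c :: "nat \<Rightarrow> trm \<Rightarrow> cmd \<Rightarrow> cmd" where
  "sub_right \<alpha> v (Var i) = Var i"
| "sub_right \<alpha> v (Lam t) = Lam (sub_right \<alpha> (lift_lam v) t)"
| "sub_right \<alpha> v (App t u) = App (sub_right \<alpha> v t) (sub_right \<alpha> v u)"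
| "sub_right \<alpha> v (Mu c) = Mu (sub_right_c (Suc \<alpha>) (lift_mu v) c)"
| "sub_right_c \<alpha> v (Named \<beta> w) =
     Named \<beta> (if \<beta> = \<alpha> then App (sub_right \<alpha> v w) v else sub_right \<alpha> v w)"

primrec sub_left :: "nat \<Rightarrow> trm \<Rightarrow> trm \<Rightarrow> trm"
  and sub_left_c :: "nat \<Rightarrow> trm \<Rightarrow> cmd \<Rightarrow> cmd" where
  "sub_left \<alpha> v (Var i) = Var i"
| "sub_left \<alpha> v (Lam t) = Lam (sub_left \<alpha> (lift_lam v) t)"
| "sub_left \<alpha> v (App t u) = App (sub_left \<alpha> v t) (sub_left \<alpha> v u)"
| "sub_left \<alpha> v (Mu c) = Mu (sub_left_c (Suc \<alpha>) (lift_mu v) c)"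
| "sub_left_c \<alpha> v (Named \<beta> w) =
     Named \<beta> (if \<beta> = \<alpha> then App v (sub_left \<alpha> v w) else sub_left \<alpha> v w)"

text \<open>\<open>names_lam \<alpha> u\<close>: \<open>u\<close> contains a subterm \<open>[\<alpha>]\<lambda>y w\<close> (\<open>\<alpha>\<close> free in \<open>u\<close>).\<close>

primrec names_lam :: "nat \<Rightarrow> trm \<Rightarrow> bool" and names_lam_c :: "nat \<Rightarrow> cmd \<Rightarrow> bool" where
  "names_lam \<alpha> (Var i) = False"
| "names_lam \<alpha> (Lam t) = names_lam \<alpha> t"
| "names_lam \<alpha> (App t u) = (names_lam \<alpha> t \<or> names_lam \<alpha> u)"
| "names_lam \<alpha> (Mu c) = names_lam_c (Suc \<alpha>) c"
| "names_lam_c \<alpha> (Named \<beta> t) = (\<beta> = \<alpha> \<and> (\<exists>w. t = Lam w) \<or> names_lam \<alpha> t)"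


section \<open>Reduction\<close>

inductive comp_rule :: "trm \<Rightarrow> trm \<Rightarrow> bool" where
  C1: "comp_rule (App (Lam u) v) (sub (case_nat v Var) u)"
| C2: "comp_rule (App (Mu c) v) (Mu (sub_right_c 0 (lift_mu v) c))"

inductive simp_rule_c :: "cmd \<Rightarrow> cmd \<Rightarrow> bool" where
  S1: "simp_rule_c (Named \<alpha> (Mu c)) (ren_c id (case_nat \<alpha> id) c)"

inductive simp_rule :: "trm \<Rightarrow> trm \<Rightarrow> bool" where
  S2: "0 \<notin> fv_mu t \<Longrightarrow> simp_rule (Mu (Named 0 t)) (ren id (\<lambda>\<alpha>. \<alpha> - 1) t)"
| S3: "names_lam_c 0 c \<Longrightarrow>
         simp_rule (Mu c) (Lam (Mu (sub_right_c 0 (Var 0) (ren_c Suc id c))))"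

inductive clean_rule :: "trm \<Rightarrow> trm \<Rightarrow> bool" where
  N: "clean_rule (App u (Mu c)) (Mu (sub_left_c 0 (lift_mu u) c))"

text \<open>
  Application of one rule to one subterm: closure under term formation of a relation \<open>R\<close> on terms
  and a relation \<open>Q\<close> on named terms.
\<close>

inductive ctx :: "(trm \<Rightarrow> trm \<Rightarrow> bool) \<Rightarrow> (cmd \<Rightarrow> cmd \<Rightarrow> bool) \<Rightarrow> trm \<Rightarrow> trm \<Rightarrow> bool"
  and ctx_c :: "(trm \<Rightarrow> trm \<Rightarrow> bool) \<Rightarrow> (cmd \<Rightarrow> cmd \<Rightarrow> bool) \<Rightarrow> cmd \<Rightarrow> cmd \<Rightarrow> bool"
  for R :: "trm \<Rightarrow> trm \<Rightarrow> bool" and Q :: "cmd \<Rightarrow> cmd \<Rightarrow> bool" where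
  root: "R t u \<Longrightarrow> ctx R Q t u"
| root_c: "Q c d \<Longrightarrow> ctx_c R Q c d"
| Lam: "ctx R Q t u \<Longrightarrow> ctx R Q (Lam t) (Lam u)"
| AppL: "ctx R Q t u \<Longrightarrow> ctx R Q (App t v) (App u v)"
| AppR: "ctx R Q t u \<Longrightarrow> ctx R Q (App v t) (App v u)"
| Mu: "ctx_c R Q c d \<Longrightarrow> ctx R Q (Mu c) (Mu d)"
| Named: "ctx R Q t u \<Longrightarrow> ctx_c R Q (Named \<alpha> t) (Named \<alpha> u)"

definition comp_step :: "trm \<Rightarrow> trm \<Rightarrow> bool" where
  "comp_step = ctx comp_rule (\<lambda>_ _. False)"

definition simp_step :: "trm \<Rightarrow> trm \<Rightarrow> bool" where
  "simp_step = ctx simp_rule simp_rule_c"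

definition clean_step :: "trm \<Rightarrow> trm \<Rightarrow> bool" where
  "clean_step = ctx clean_rule (\<lambda>_ _. False)"

definition normal :: "trm \<Rightarrow> bool" where
  "normal t \<longleftrightarrow> \<not> (\<exists>u. comp_step t u \<or> simp_step t u)"

definition hook_step :: "trm \<Rightarrow> trm \<Rightarrow> bool" where
  "hook_step u v \<longleftrightarrow>
     (\<exists>w. (w = u \<or> clean_step u w) \<and> simp_step\<^sup>*\<^sup>* w v \<and> \<not> (\<exists>v'. simp_step v v'))"

definition hook :: "trm \<Rightarrow> trm \<Rightarrow> bool" (infix "\<hookrightarrow>" 50) where
  "u \<hookrightarrow> v \<longleftrightarrow> hook_step\<^sup>*\<^sup>* u v"


section \<open>First-order terms and equational consequence\<close>

text \<open>
  The language is given by a type \<open>'f\<close> of function symbols with arities \<open>ar\<close>; \<open>wf_tm ar\<close> singles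
  out the terms that respect the arities.
\<close>

datatype 'f tm = FVar nat | Fn 'f "'f tm list"

fun wf_tm :: "('f \<Rightarrow> nat) \<Rightarrow> 'f tm \<Rightarrow> bool" where
  "wf_tm ar (FVar i) = True"
| "wf_tm ar (Fn f ts) = (length ts = ar f \<and> (\<forall>t\<in>set ts. wf_tm ar t))"

primrec sub_tm :: "(nat \<Rightarrow> 'f tm) \<Rightarrow> 'f tm \<Rightarrow> 'f tm" where
  "sub_tm \<sigma> (FVar i) = \<sigma> i"
| "sub_tm \<sigma> (Fn f ts) = Fn f (map (sub_tm \<sigma>) ts)"

text \<open>Equational consequence; the equations in \<open>E\<close> are understood as universally closed.\<close>

inductive eq_conseq :: "('f \<Rightarrow> nat) \<Rightarrow> ('f tm \<times> 'f tm) set \<Rightarrow> 'f tm \<Rightarrow> 'f tm \<Rightarrow> bool"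
  for ar :: "'f \<Rightarrow> nat" and E :: "('f tm \<times> 'f tm) set" where
  eq_inst: "\<lbrakk>(u, v) \<in> E; \<forall>i. wf_tm ar (\<sigma> i)\<rbrakk> \<Longrightarrow> eq_conseq ar E (sub_tm \<sigma> u) (sub_tm \<sigma> v)"
| eq_refl: "wf_tm ar u \<Longrightarrow> eq_conseq ar E u u"
| eq_sym: "eq_conseq ar E u v \<Longrightarrow> eq_conseq ar E v u"
| eq_trans: "\<lbrakk>eq_conseq ar E u v; eq_conseq ar E v w\<rbrakk> \<Longrightarrow> eq_conseq ar E u w"
| eq_cong: "\<lbrakk>length us = ar f; list_all2 (eq_conseq ar E) us vs\<rbrakk> \<Longrightarrow>
             eq_conseq ar E (Fn f us) (Fn f vs)"

definition adequate :: "('f \<Rightarrow> nat) \<Rightarrow> 'f \<Rightarrow> 'f \<Rightarrow> ('f tm \<times> 'f tm) set \<Rightarrow> bool" where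
  "adequate ar zr sc E \<longleftrightarrow>
     (\<forall>a. \<not> eq_conseq ar E (Fn sc [a]) (Fn zr [])) \<and>
     (\<forall>a b. eq_conseq ar E (Fn sc [a]) (Fn sc [b]) \<longrightarrow> eq_conseq ar E a b)"


section \<open>Types\<close>

text \<open>
  Second-order formulas up to renaming of bound variables. \<open>All1\<close> binds first-order index 0.
  Predicate variables have a separate family of indices for each arity: \<open>Pred X ts\<close> is the
  predicate variable with index \<open>X\<close> among those of arity \<open>length ts\<close>, applied to \<open>ts\<close>, and
  \<open>All2 n\<close> binds index 0 of the \<open>n\<close>-ary predicate variables. Thus every atom respects arities.
\<close>

datatype 'f fm = Pred nat "'f tm list" | Bot | Imp "'f fm" "'f fm" | All1 "'f fm" | All2 nat "'f fm"

primrec wf_fm :: "('f \<Rightarrow> nat) \<Rightarrow> 'f fm \<Rightarrow> bool" where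
  "wf_fm ar (Pred X ts) = (\<forall>t\<in>set ts. wf_tm ar t)"
| "wf_fm ar Bot = True"
| "wf_fm ar (Imp A B) = (wf_fm ar A \<and> wf_fm ar B)"
| "wf_fm ar (All1 A) = wf_fm ar A"
| "wf_fm ar (All2 n A) = wf_fm ar A"

primrec up_tm :: "(nat \<Rightarrow> 'f tm) \<Rightarrow> nat \<Rightarrow> 'f tm" where
  "up_tm \<sigma> 0 = FVar 0"
| "up_tm \<sigma> (Suc i) = sub_tm (\<lambda>j. FVar (Suc j)) (\<sigma> i)"

primrec sub1 :: "(nat \<Rightarrow> 'f tm) \<Rightarrow> 'f fm \<Rightarrow> 'f fm" where
  "sub1 \<sigma> (Pred X ts) = Pred X (map (sub_tm \<sigma>) ts)"
| "sub1 \<sigma> Bot = Bot"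
| "sub1 \<sigma> (Imp A B) = Imp (sub1 \<sigma> A) (sub1 \<sigma> B)"
| "sub1 \<sigma> (All1 A) = All1 (sub1 (up_tm \<sigma>) A)"
| "sub1 \<sigma> (All2 n A) = All2 n (sub1 \<sigma> A)"

definition lift1 :: "'f fm \<Rightarrow> 'f fm" where
  "lift1 = sub1 (\<lambda>i. FVar (Suc i))"

definition inst1 :: "'f tm \<Rightarrow> 'f fm \<Rightarrow> 'f fm" where
  "inst1 u = sub1 (case_nat u FVar)"

text \<open>\<open>ren2 \<rho>\<close> renames the free \<open>n\<close>-ary predicate variables by \<open>\<rho> n\<close>.\<close>

primrec ren2 :: "(nat \<Rightarrow> nat \<Rightarrow> nat) \<Rightarrow> 'f fm \<Rightarrow> 'f fm" where
  "ren2 \<rho> (Pred X ts) = Pred (\<rho> (length ts) X) ts"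
| "ren2 \<rho> Bot = Bot"
| "ren2 \<rho> (Imp A B) = Imp (ren2 \<rho> A) (ren2 \<rho> B)"
| "ren2 \<rho> (All1 A) = All1 (ren2 \<rho> A)"
| "ren2 \<rho> (All2 n A) = All2 n (ren2 (\<rho>(n := up (\<rho> n))) A)"

definition lift2 :: "nat \<Rightarrow> 'f fm \<Rightarrow> 'f fm" where
  "lift2 n = ren2 ((\<lambda>_. id)(n := Suc))"

text \<open>
  Second-order substitution. To replace an \<open>n\<close>-ary predicate variable one needs a formula \<open>G\<close> with
  \<open>n\<close> distinguished first-order variables \<open>x\<^sub>1,\<dots>,x\<^sub>n\<close>: these are the indices \<open>0,\<dots>,n-1\<close> of \<open>G\<close>, and
  the index \<open>n + i\<close> of \<open>G\<close> stands for the ambient first-order variable \<open>i\<close>. An atom \<open>X(ts)\<close> becomes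
  \<open>G[ts/x\<^sub>1,\<dots>,x\<^sub>n]\<close>, computed by \<open>apply_params\<close>.
\<close>

definition apply_params :: "'f tm list \<Rightarrow> 'f fm \<Rightarrow> 'f fm" where
  "apply_params ts = sub1 (\<lambda>i. if i < length ts then ts ! i else FVar (i - length ts))"

definition lift1_params :: "nat \<Rightarrow> 'f fm \<Rightarrow> 'f fm" where
  "lift1_params n = sub1 (\<lambda>i. if i < n then FVar i else FVar (Suc i))"

definition pvar :: "nat \<Rightarrow> nat \<Rightarrow> 'f fm" where
  "pvar n X = Pred X (map FVar [0..<n])"

definition up_sub2 :: "nat \<Rightarrow> (nat \<Rightarrow> nat \<Rightarrow> 'f fm) \<Rightarrow> nat \<Rightarrow> nat \<Rightarrow> 'f fm" where
  "up_sub2 m \<Theta> n =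
     (if n = m then case_nat (pvar n 0) (\<lambda>X. lift2 m (\<Theta> n X)) else (\<lambda>X. lift2 m (\<Theta> n X)))"

primrec sub2 :: "(nat \<Rightarrow> nat \<Rightarrow> 'f fm) \<Rightarrow> 'f fm \<Rightarrow> 'f fm" where
  "sub2 \<Theta> (Pred X ts) = apply_params ts (\<Theta> (length ts) X)"
| "sub2 \<Theta> Bot = Bot"
| "sub2 \<Theta> (Imp A B) = Imp (sub2 \<Theta> A) (sub2 \<Theta> B)"
| "sub2 \<Theta> (All1 A) = All1 (sub2 (\<lambda>n X. lift1_params n (\<Theta> n X)) A)"
| "sub2 \<Theta> (All2 m A) = All2 m (sub2 (up_sub2 m \<Theta>) A)"

definition inst2 :: "nat \<Rightarrow> 'f fm \<Rightarrow> 'f fm \<Rightarrow> 'f fm" where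
  "inst2 n G = sub2 (pvar(n := case_nat G (pvar n)))"


section \<open>Typing\<close>

text \<open>
  \<open>typing ar E \<Gamma> t A \<Delta>\<close> is the judgment \<open>\<Gamma> \<turnstile> t : A, \<Delta>\<close>. The contexts list the types of the
  \<open>\<lambda>\<close>-variables and of the \<open>\<mu>\<close>-variables by de Bruijn index. They may contain declarations of
  variables not occurring in \<open>t\<close> (\<open>ty_var\<close> allows arbitrary contexts), which provides the weakening
  in \<open>ty_lam\<close>, \<open>ty_mu_same\<close> and \<open>ty_mu_other\<close>; in \<open>ty_mu_other\<close> the declaration \<open>\<alpha> : A\<close> is shared by
  premise and conclusion, which provides the contraction. The premises of \<open>ty_all1I\<close> and \<open>ty_all2I\<close>
  have lifted contexts: the generalised variable is not free in them.
\<close>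

inductive typing ::
  "('f \<Rightarrow> nat) \<Rightarrow> ('f tm \<times> 'f tm) set \<Rightarrow> 'f fm list \<Rightarrow> trm \<Rightarrow> 'f fm \<Rightarrow> 'f fm list \<Rightarrow> bool"
  for ar :: "'f \<Rightarrow> nat" and E :: "('f tm \<times> 'f tm) set" where
  ty_var: "\<lbrakk>i < length \<Gamma>; \<forall>A \<in> set \<Gamma> \<union> set \<Delta>. wf_fm ar A\<rbrakk> \<Longrightarrow> typing ar E \<Gamma> (Var i) (\<Gamma> ! i) \<Delta>"
| ty_lam: "typing ar E (A # \<Gamma>) t B \<Delta> \<Longrightarrow> typing ar E \<Gamma> (Lam t) (Imp A B) \<Delta>"
| ty_app: "\<lbrakk>typing ar E \<Gamma> u (Imp A B) \<Delta>; typing ar E \<Gamma> v A \<Delta>\<rbrakk> \<Longrightarrow> typing ar E \<Gamma> (App u v) B \<Delta>"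
| ty_all1I: "typing ar E (map lift1 \<Gamma>) t A (map lift1 \<Delta>) \<Longrightarrow> typing ar E \<Gamma> t (All1 A) \<Delta>"
| ty_all1E: "\<lbrakk>typing ar E \<Gamma> t (All1 A) \<Delta>; wf_tm ar u\<rbrakk> \<Longrightarrow> typing ar E \<Gamma> t (inst1 u A) \<Delta>"
| ty_all2I: "typing ar E (map (lift2 n) \<Gamma>) t A (map (lift2 n) \<Delta>) \<Longrightarrow>
               typing ar E \<Gamma> t (All2 n A) \<Delta>"
| ty_all2E: "\<lbrakk>typing ar E \<Gamma> t (All2 n A) \<Delta>; wf_fm ar G\<rbrakk> \<Longrightarrow> typing ar E \<Gamma> t (inst2 n G A) \<Delta>"
| ty_eq: "\<lbrakk>typing ar E \<Gamma> t (inst1 u A) \<Delta>; eq_conseq ar E u v\<rbrakk> \<Longrightarrow>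
            typing ar E \<Gamma> t (inst1 v A) \<Delta>"
| ty_mu_other: "\<lbrakk>typing ar E \<Gamma> t A (B # \<Delta>); \<alpha> < length \<Delta>; \<Delta> ! \<alpha> = A\<rbrakk> \<Longrightarrow>
                  typing ar E \<Gamma> (Mu (Named (Suc \<alpha>) t)) B \<Delta>"
| ty_mu_same: "typing ar E \<Gamma> t B (B # \<Delta>) \<Longrightarrow> typing ar E \<Gamma> (Mu (Named 0 t)) B \<Delta>"


section \<open>Classical integers\<close>

definition nat_type :: "'f \<Rightarrow> 'f \<Rightarrow> 'f tm \<Rightarrow> 'f fm" where
  "nat_type zr sc a =
     All2 1 (Imp (Pred 0 [Fn zr []])
              (Imp (All1 (Imp (Pred 0 [FVar 0]) (Pred 0 [Fn sc [FVar 0]])))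
                (Pred 0 [a])))"

definition num_tm :: "'f \<Rightarrow> 'f \<Rightarrow> nat \<Rightarrow> 'f tm" where
  "num_tm zr sc n = ((\<lambda>a. Fn sc [a]) ^^ n) (Fn zr [])"

definition classical_integer ::
  "('f \<Rightarrow> nat) \<Rightarrow> 'f \<Rightarrow> 'f \<Rightarrow> ('f tm \<times> 'f tm) set \<Rightarrow> nat \<Rightarrow> trm \<Rightarrow> bool" where
  "classical_integer ar zr sc E n \<theta> \<longleftrightarrow>
     closed \<theta> \<and> typing ar E [] \<theta> (nat_type zr sc (num_tm zr sc n)) []"

definition church :: "nat \<Rightarrow> trm" where
  "church n = Lam (Lam ((App (Var 0) ^^ n) (Var 1)))"

end

theory Submission
  imports Defs
begin

text \<open>
  Typing enters the proof only through one realizability argument. The term \<open>\<theta>\<close> is run on a Krivine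
  machine, applied to two constants: \<open>XC\<close> stands for the zero and \<open>FC\<close> for the successor. A stack is
  a list of arguments ending in a counter \<open>SK k\<close>, and \<open>FC\<close> consumes one argument by incrementing the
  counter and evaluating that argument. Interpret the predicate variable of the type of integers at
  \<open>a\<close> by the set of counters \<open>k\<close> such that \<open>E\<close> proves \<open>s\<^sup>k(a) = s\<^sup>n(0)\<close>. By adequacy of \<open>E\<close>, the only
  counter at \<open>0\<close> is \<open>n\<close>, so \<open>XC\<close> and \<open>FC\<close> realize the two premises of the type, and
  \<open>adequacy\<close> (the realizability theorem) yields that \<open>\<theta>\<close> applied to \<open>XC\<close> and \<open>FC\<close> with counter \<open>0\<close> ends in \<open>XC\<close>
  with counter \<open>n\<close>.

  In particular the run does not get stuck, which for a normal term forces the syntax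
  (\<open>good_Push_Lam\<close>, \<open>good_body\<close>): \<open>\<theta> = \<lambda>x\<lambda>f t\<close> where \<open>t\<close> is generated by \<open>x\<close>, \<open>(f)t\<close> and
  \<open>\<mu>\<alpha>[\<beta>]t\<close>. The run thus follows a single path through \<open>t\<close>, and its final counter is
  given by the recursive function \<open>val\<close>. Both the simplification rules and \<open>(N)\<close> preserve \<open>val\<close>
  (\<open>simp_step_body\<close>, \<open>val_sub_left\<close>).

  For the cleaning itself, always apply \<open>(N)\<close> at the innermost \<open>\<mu>\<close>. This keeps the number of \<open>\<mu>\<close>s
  and brings the innermost \<open>\<mu>\<close> one application nearer to the next \<open>[\<beta>]\<close> outside it, while
  \<open>(S\<^sub>1)\<close> and \<open>(S\<^sub>2)\<close>, the only simplifications possible in \<open>t\<close>, each remove a \<open>\<mu>\<close>; so the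
  process ends. In the final term no \<open>\<mu>\<close> can be
  left: it would be under an \<open>f\<close> (an \<open>(N)\<close>-redex), under a name (an \<open>(S\<^sub>1)\<close>-redex), or
  at the top of a term without free \<open>\<mu>\<close>-variables (an \<open>(S\<^sub>2)\<close>-redex). Hence the final term is
  \<open>\<lambda>x\<lambda>f (f)\<^sup>j x\<close>, and \<open>j = n\<close> because \<open>val\<close> has not changed.
\<close>

section \<open>An abstract machine with two constants\<close>

text \<open>
  Using closures in place of substituted terms keeps the subterms of \<open>\<theta>\<close> intact during a run, so that
  normality of \<open>\<theta>\<close> stays applicable to the code being executed. The second environment of a closure
  gives the stacks saved by \<open>\<mu>\<close>.
\<close>

datatype clo = XC | FC | Clo trm "clo list" "stk list"
  and stk = SK nat | Push clo stk

text \<open>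
  The process consisting of a closure and a stack ends in \<open>XC\<close> with counter \<open>N\<close>. Being defined
  backwards along the machine transitions, the predicate is closed under anti-reduction, as needed for
  the pole of a realizability model; an ill-scoped variable or an abstraction facing a counter is stuck.
\<close>

inductive good :: "nat \<Rightarrow> clo \<Rightarrow> stk \<Rightarrow> bool" for N :: nat where
  good_XC: "good N XC (SK N)"
| good_FC: "good N c (SK (Suc k)) \<Longrightarrow> good N FC (Push c (SK k))"
| good_Var: "i < length es \<Longrightarrow> good N (es ! i) \<pi> \<Longrightarrow> good N (Clo (Var i) es ms) \<pi>"
| good_Lam: "good N (Clo t (c # es) ms) \<pi> \<Longrightarrow> good N (Clo (Lam t) es ms) (Push c \<pi>)"
| good_App: "good N (Clo t es ms) (Push (Clo u es ms) \<pi>) \<Longrightarrow> good N (Clo (App t u) es ms) \<pi>"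
| good_Mu: "\<beta> < length (\<pi> # ms) \<Longrightarrow> good N (Clo t es (\<pi> # ms)) ((\<pi> # ms) ! \<beta>) \<Longrightarrow>
    good N (Clo (Mu (Named \<beta> t)) es ms) \<pi>"

inductive_cases good_XC_E: "good N XC \<pi>"
inductive_cases good_FC_E: "good N FC \<pi>"
inductive_cases good_Var_E: "good N (Clo (Var i) es ms) \<pi>"
inductive_cases good_Lam_E: "good N (Clo (Lam t) es ms) \<pi>"
inductive_cases good_App_E: "good N (Clo (App t u) es ms) \<pi>"
inductive_cases good_Mu_E: "good N (Clo (Mu c) es ms) \<pi>"


section \<open>Well-formedness and equations under substitution\<close>

lemma sub_tm_sub_tm: "sub_tm \<rho> (sub_tm \<sigma> t) = sub_tm (\<lambda>i. sub_tm \<rho> (\<sigma> i)) t"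
  by (induction t) auto

lemma wf_tm_sub_tm: "(\<forall>i. wf_tm ar (\<sigma> i)) \<Longrightarrow> wf_tm ar (sub_tm \<sigma> t) \<longleftrightarrow> wf_tm ar t"
  by (induction t) auto

lemma wf_fm_sub1: "(\<forall>i. wf_tm ar (\<sigma> i)) \<Longrightarrow> wf_fm ar (sub1 \<sigma> A) \<longleftrightarrow> wf_fm ar A"
proof (induction A arbitrary: \<sigma>)
  case (All1 A)
  have "\<forall>i. wf_tm ar (up_tm \<sigma> i)"
  proof
    fix i show "wf_tm ar (up_tm \<sigma> i)" using All1.prems by (cases i) (auto simp: wf_tm_sub_tm)
  qed
  then show ?case using All1.IH by simp
qed (auto simp: wf_tm_sub_tm)

lemma wf_fm_ren2: "wf_fm ar (ren2 r A) \<longleftrightarrow> wf_fm ar A"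
  by (induction A arbitrary: r) auto

lemma wf_fm_inst1: "wf_tm ar u \<Longrightarrow> wf_fm ar (inst1 u A) \<longleftrightarrow> wf_fm ar A"
  unfolding inst1_def by (rule wf_fm_sub1) (auto split: nat.split)

lemma wf_fm_lift1: "wf_fm ar (lift1 A) \<longleftrightarrow> wf_fm ar A"
  unfolding lift1_def by (rule wf_fm_sub1) auto

lemma wf_fm_sub2:
  "wf_fm ar A \<Longrightarrow> (\<forall>n X. wf_fm ar (\<Theta> n X)) \<Longrightarrow> wf_fm ar (sub2 \<Theta> A)"
proof (induction A arbitrary: \<Theta>)
  case (Pred X ts)
  then have "wf_tm ar (if i < length ts then ts ! i else FVar (i - length ts))" for i by simp
  then show ?case using Pred by (auto simp: apply_params_def wf_fm_sub1)
next
  case (All1 A)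
  then show ?case by (auto simp: lift1_params_def wf_fm_sub1)
next
  case (All2 m A)
  have "wf_fm ar (up_sub2 m \<Theta> n X)" for n X
    using All2.prems by (auto simp: up_sub2_def lift2_def wf_fm_ren2 pvar_def split: nat.split)
  then show ?case using All2 by simp
qed auto

lemma wf_fm_inst2: "wf_fm ar A \<Longrightarrow> wf_fm ar G \<Longrightarrow> wf_fm ar (inst2 n G A)"
  unfolding inst2_def by (rule wf_fm_sub2) (auto simp: pvar_def split: nat.split)

lemma eq_conseq_wf:
  assumes "\<forall>(u, v) \<in> E. wf_tm ar u \<and> wf_tm ar v"
  shows "eq_conseq ar E u v \<Longrightarrow> wf_tm ar u \<and> wf_tm ar v"
proof (induction rule: eq_conseq.induct)
  case (eq_inst u v \<sigma>)
  then show ?case using assms by (auto simp: wf_tm_sub_tm)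
next
  case (eq_cong us f vs)
  then show ?case by (auto simp: list_all2_conv_all_nth in_set_conv_nth)
qed auto

lemma eq_conseq_sub:
  assumes "\<forall>i. wf_tm ar (\<rho> i)"
  shows "eq_conseq ar E u v \<Longrightarrow> eq_conseq ar E (sub_tm \<rho> u) (sub_tm \<rho> v)"
proof (induction rule: eq_conseq.induct)
  case (eq_inst u v \<sigma>)
  then have "\<forall>i. wf_tm ar (sub_tm \<rho> (\<sigma> i))" using assms by (simp add: wf_tm_sub_tm)
  then show ?case using eq_inst by (auto simp: sub_tm_sub_tm intro: eq_conseq.eq_inst)
next
  case (eq_refl u)
  then show ?case using assms by (auto simp: wf_tm_sub_tm intro: eq_conseq.eq_refl)
next
  case (eq_cong us f vs)
  then show ?case by (auto simp: list_all2_conv_all_nth intro!: eq_conseq.eq_cong)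
qed (auto intro: eq_conseq.eq_sym eq_conseq.eq_trans)

lemma eq_conseq_sub_cong:
  assumes "\<forall>i. eq_conseq ar E (\<rho> i) (\<rho>' i)"
  shows "wf_tm ar t \<Longrightarrow> eq_conseq ar E (sub_tm \<rho> t) (sub_tm \<rho>' t)"
proof (induction t)
  case (Fn f ts)
  then show ?case by (auto simp: list_all2_conv_all_nth intro!: eq_conseq.eq_cong)
qed (use assms in auto)

lemma typing_wf:
  assumes "\<forall>(u, v) \<in> E. wf_tm ar u \<and> wf_tm ar v"
  shows "typing ar E \<Gamma> t A \<Delta> \<Longrightarrow> wf_fm ar A \<and> (\<forall>B \<in> set \<Gamma>. wf_fm ar B) \<and> (\<forall>B \<in> set \<Delta>. wf_fm ar B)"
proof (induction rule: typing.induct)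
  case (ty_eq \<Gamma> t u A \<Delta> v)
  then show ?case using eq_conseq_wf[OF assms] by (metis wf_fm_inst1)
next
  case (ty_mu_other \<Gamma> t A B \<Delta> \<alpha>)
  then show ?case by auto
qed (auto simp: wf_fm_lift1 lift2_def wf_fm_ren2 wf_fm_inst1 wf_fm_inst2)


section \<open>Realizability\<close>

text \<open>
  Second-order quantifiers range over these predicates only: first-order variables are interpreted by
  terms rather than by their classes modulo \<open>E\<close>, so compatibility with \<open>E\<close> must be required for
  the rule that rewrites a type along an equation to be sound.
\<close>

definition invariant :: "('f \<Rightarrow> nat) \<Rightarrow> ('f tm \<times> 'f tm) set \<Rightarrow> ('f tm list \<Rightarrow> stk set) \<Rightarrow> bool" where
  "invariant ar E P \<longleftrightarrow> (\<forall>ts us. list_all2 (eq_conseq ar E) ts us \<longrightarrow> P ts = P us)"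

text \<open>Krivine's falsity values, with the pole \<open>good N\<close>: the stacks that test a realizer.\<close>

primrec falsity :: "nat \<Rightarrow> ('f \<Rightarrow> nat) \<Rightarrow> ('f tm \<times> 'f tm) set \<Rightarrow> 'f fm \<Rightarrow>
    (nat \<Rightarrow> 'f tm) \<Rightarrow> (nat \<Rightarrow> nat \<Rightarrow> 'f tm list \<Rightarrow> stk set) \<Rightarrow> stk set" where
  "falsity N ar E (Pred X ts) \<rho> \<eta> = \<eta> (length ts) X (map (sub_tm \<rho>) ts)"
| "falsity N ar E Bot \<rho> \<eta> = {}"
| "falsity N ar E (Imp A B) \<rho> \<eta> =
     {Push c \<pi> |c \<pi>. (\<forall>\<pi>' \<in> falsity N ar E A \<rho> \<eta>. good N c \<pi>') \<and> \<pi> \<in> falsity N ar E B \<rho> \<eta>}"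
| "falsity N ar E (All1 A) \<rho> \<eta> = (\<Union>a \<in> {a. wf_tm ar a}. falsity N ar E A (case_nat a \<rho>) \<eta>)"
| "falsity N ar E (All2 n A) \<rho> \<eta> =
     (\<Union>P \<in> {P. invariant ar E P}. falsity N ar E A \<rho> (\<eta>(n := case_nat P (\<eta> n))))"

definition realizes :: "nat \<Rightarrow> ('f \<Rightarrow> nat) \<Rightarrow> ('f tm \<times> 'f tm) set \<Rightarrow>
    (nat \<Rightarrow> 'f tm) \<Rightarrow> (nat \<Rightarrow> nat \<Rightarrow> 'f tm list \<Rightarrow> stk set) \<Rightarrow> clo \<Rightarrow> 'f fm \<Rightarrow> bool" where
  "realizes N ar E \<rho> \<eta> c A \<longleftrightarrow> (\<forall>\<pi> \<in> falsity N ar E A \<rho> \<eta>. good N c \<pi>)"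

lemma falsity_sub1:
  "falsity N ar E (sub1 \<sigma> A) \<rho> \<eta> = falsity N ar E A (\<lambda>i. sub_tm \<rho> (\<sigma> i)) \<eta>"
proof (induction A arbitrary: \<sigma> \<rho> \<eta>)
  case (All1 A)
  have "(\<lambda>i. sub_tm (case_nat a \<rho>) (up_tm \<sigma> i)) = case_nat a (\<lambda>i. sub_tm \<rho> (\<sigma> i))" for a
    by (rule ext) (auto simp: sub_tm_sub_tm split: nat.split)
  then show ?case using All1.IH by simp
qed (simp_all add: sub_tm_sub_tm comp_def)

lemma falsity_ren2:
  "falsity N ar E (ren2 r A) \<rho> \<eta> = falsity N ar E A \<rho> (\<lambda>n X. \<eta> n (r n X))"
proof (induction A arbitrary: r \<rho> \<eta>)
  case (All2 n A)
  have "(\<lambda>k X. (\<eta>(n := case_nat P (\<eta> n))) k ((r(n := up (r n))) k X)) =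
      (\<lambda>k X. \<eta> k (r k X))(n := case_nat P (\<lambda>X. \<eta> n (r n X)))" for P
    by (rule ext, rule ext) (auto split: nat.split)
  then show ?case using All2.IH by simp
qed simp_all

lemma falsity_lift2:
  "falsity N ar E (lift2 n A) \<rho> (\<eta>(n := case_nat P (\<eta> n))) = falsity N ar E A \<rho> \<eta>"
proof -
  have "(\<lambda>k X. (\<eta>(n := case_nat P (\<eta> n))) k (((\<lambda>_. id)(n := Suc)) k X)) = \<eta>"
    by (rule ext, rule ext) auto
  then show ?thesis by (simp add: lift2_def falsity_ren2)
qed

text \<open>
  The hypothesis relates the two valuations on lists of the right length only. Elsewhere they may
  disagree: the formula \<open>pvar n X\<close> standing for a variable under a binder has exactly \<open>n\<close> parameters.
\<close>

lemma falsity_sub2: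
  assumes "\<And>n X ts. length ts = n \<Longrightarrow>
    \<eta>' n X ts = falsity N ar E (\<Theta> n X) (\<lambda>i. if i < n then ts ! i else \<rho> (i - n)) \<eta>"
  shows "falsity N ar E (sub2 \<Theta> A) \<rho> \<eta> = falsity N ar E A \<rho> \<eta>'"
  using assms
proof (induction A arbitrary: \<Theta> \<rho> \<eta> \<eta>')
  case (Pred X ts)
  have "(\<lambda>i. sub_tm \<rho> (if i < length ts then ts ! i else FVar (i - length ts))) =
      (\<lambda>i. if i < length ts then map (sub_tm \<rho>) ts ! i else \<rho> (i - length ts))"
    by (rule ext) auto
  then show ?case using Pred by (simp add: apply_params_def falsity_sub1)
next
  case (All1 A)
  have "falsity N ar E (sub2 (\<lambda>n X. lift1_params n (\<Theta> n X)) A) (case_nat a \<rho>) \<eta>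
      = falsity N ar E A (case_nat a \<rho>) \<eta>'" for a
  proof (rule All1.IH)
    fix n X and ts :: "'a tm list" assume "length ts = n"
    have "(\<lambda>i. sub_tm (\<lambda>i. if i < n then ts ! i else case i - n of 0 \<Rightarrow> a | Suc j \<Rightarrow> \<rho> j)
            (if i < n then FVar i else FVar (Suc i)))
        = (\<lambda>i. if i < n then ts ! i else \<rho> (i - n))"
      by (rule ext) (auto simp: Suc_diff_le)
    then show "\<eta>' n X ts = falsity N ar E (lift1_params n (\<Theta> n X))
        (\<lambda>i. if i < n then ts ! i else case i - n of 0 \<Rightarrow> a | Suc j \<Rightarrow> \<rho> j) \<eta>"
      using All1.prems[OF \<open>length ts = n\<close>] by (simp add: lift1_params_def falsity_sub1)
  qed
  then show ?case by simp
next
  case (All2 m A)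
  have "falsity N ar E (sub2 (up_sub2 m \<Theta>) A) \<rho> (\<eta>(m := case_nat P (\<eta> m)))
      = falsity N ar E A \<rho> (\<eta>'(m := case_nat P (\<eta>' m)))" for P
  proof (rule All2.IH)
    fix n X and ts :: "'a tm list" assume len: "length ts = n"
    let ?\<rho> = "\<lambda>i. if i < n then ts ! i else \<rho> (i - n)"
    have ts: "map (\<lambda>i. if i < n then ts ! i else \<rho> (i - n)) [0..<n] = ts"
      using len by (auto intro: nth_equalityI)
    show "(\<eta>'(m := case_nat P (\<eta>' m))) n X ts
        = falsity N ar E (up_sub2 m \<Theta> n X) ?\<rho> (\<eta>(m := case_nat P (\<eta> m)))"
    proof (cases "n = m \<and> X = 0")
      case True
      then show ?thesis using ts by (simp add: up_sub2_def pvar_def comp_def len)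
    next
      case False
      then have "up_sub2 m \<Theta> n X = lift2 m (\<Theta> n (if n = m then X - 1 else X))"
        by (cases X) (auto simp: up_sub2_def)
      moreover have "(\<eta>'(m := case_nat P (\<eta>' m))) n X ts = \<eta>' n (if n = m then X - 1 else X) ts"
        using False by (cases X) auto
      ultimately show ?thesis using All2.prems[OF len] by (simp only: falsity_lift2)
    qed
  qed
  then show ?case by simp
next
  case (Imp A B)
  from Imp.IH(1)[OF Imp.prems] Imp.IH(2)[OF Imp.prems] show ?case by simp
qed simp_all

lemma falsity_eq_conseq:
  assumes "wf_fm ar A" and "\<forall>i. eq_conseq ar E (\<rho> i) (\<rho>' i)" and "\<forall>n X. invariant ar E (\<eta> n X)"
  shows "falsity N ar E A \<rho> \<eta> = falsity N ar E A \<rho>' \<eta>"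
  using assms
proof (induction A arbitrary: \<rho> \<rho>' \<eta>)
  case (Pred X ts)
  then have "list_all2 (eq_conseq ar E) (map (sub_tm \<rho>) ts) (map (sub_tm \<rho>') ts)"
    by (auto simp: list_all2_conv_all_nth eq_conseq_sub_cong)
  then show ?case using Pred.prems(3) unfolding invariant_def by simp
next
  case (Imp A B)
  have "falsity N ar E A \<rho> \<eta> = falsity N ar E A \<rho>' \<eta>" "falsity N ar E B \<rho> \<eta> = falsity N ar E B \<rho>' \<eta>"
    using Imp by auto
  then show ?case by simp
next
  case (All1 A)
  have "falsity N ar E A (case_nat a \<rho>) \<eta> = falsity N ar E A (case_nat a \<rho>') \<eta>" if "wf_tm ar a" for a
    using All1 that by (intro All1.IH) (auto split: nat.split intro: eq_conseq.eq_refl)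
  then show ?case by simp
next
  case (All2 n A)
  have "falsity N ar E A \<rho> (\<eta>(n := case_nat P (\<eta> n))) = falsity N ar E A \<rho>' (\<eta>(n := case_nat P (\<eta> n)))"
    if "invariant ar E P" for P
    using All2 that by (intro All2.IH) (auto split: nat.split)
  then show ?case by simp
qed simp

lemma realizes_lift1:
  "realizes N ar E (case_nat a \<rho>) \<eta> c (lift1 A) \<longleftrightarrow> realizes N ar E \<rho> \<eta> c A"
  and falsity_lift1: "falsity N ar E (lift1 A) (case_nat a \<rho>) \<eta> = falsity N ar E A \<rho> \<eta>"
  by (simp_all add: realizes_def lift1_def falsity_sub1)

lemma falsity_inst1:
  "falsity N ar E (inst1 u A) \<rho> \<eta> = falsity N ar E A (case_nat (sub_tm \<rho> u) \<rho>) \<eta>"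
proof -
  have "(\<lambda>i. sub_tm \<rho> (case i of 0 \<Rightarrow> u | Suc j \<Rightarrow> FVar j)) = case_nat (sub_tm \<rho> u) \<rho>"
    by (rule ext) (auto split: nat.split)
  then show ?thesis by (simp add: inst1_def falsity_sub1)
qed

text \<open>
  The predicate defined by \<open>G\<close> is cut off at lists of length different from \<open>n\<close>: on shorter
  lists \<open>ts ! i\<close> is unspecified, which would spoil invariance under \<open>E\<close>.
\<close>

lemma falsity_inst2:
  "falsity N ar E (inst2 n G A) \<rho> \<eta> = falsity N ar E A \<rho> (\<eta>(n := case_nat
     (\<lambda>ts. if length ts = n then falsity N ar E G (\<lambda>i. if i < n then ts ! i else \<rho> (i - n)) \<eta> else {})
     (\<eta> n)))"
  unfolding inst2_def
proof (rule falsity_sub2)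
  fix k X and ts :: "'a tm list" assume len: "length ts = k"
  have "map (\<lambda>i. if i < k then ts ! i else \<rho> (i - k)) [0..<k] = ts"
    using len by (auto intro: nth_equalityI)
  then show "(\<eta>(n := case_nat
     (\<lambda>ts. if length ts = n then falsity N ar E G (\<lambda>i. if i < n then ts ! i else \<rho> (i - n)) \<eta> else {})
     (\<eta> n))) k X ts
    = falsity N ar E ((pvar(n := case_nat G (pvar n))) k X)
       (\<lambda>i. if i < k then ts ! i else \<rho> (i - k)) \<eta>"
    using len by (auto simp: pvar_def comp_def split: nat.split)
qed

text \<open>
  Soundness of typing for the realizability model. For \<open>\<mu>\<close>, the stack that tests the conclusion is itself
  the value needed for the new \<open>\<mu>\<close>-variable in the premise.
\<close>

theorem adequacy:
  assumes E: "\<forall>(u, v) \<in> E. wf_tm ar u \<and> wf_tm ar v"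
    and "typing ar E \<Gamma> t A \<Delta>"
    and "\<forall>i. wf_tm ar (\<rho> i)" and "\<forall>n X. invariant ar E (\<eta> n X)"
    and "list_all2 (realizes N ar E \<rho> \<eta>) es \<Gamma>"
    and "list_all2 (\<lambda>\<pi> B. \<pi> \<in> falsity N ar E B \<rho> \<eta>) ms \<Delta>"
  shows "realizes N ar E \<rho> \<eta> (Clo t es ms) A"
  using assms(2-)
proof (induction arbitrary: \<rho> \<eta> es ms rule: typing.induct)
  case (ty_var i \<Gamma> \<Delta>)
  then show ?case by (auto simp: realizes_def list_all2_conv_all_nth intro!: good_Var)
next
  case (ty_lam A \<Gamma> t B \<Delta>)
  show ?case unfolding realizes_def
  proof
    fix \<pi> assume "\<pi> \<in> falsity N ar E (Imp A B) \<rho> \<eta>"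
    then obtain c \<pi>' where \<pi>: "\<pi> = Push c \<pi>'" "realizes N ar E \<rho> \<eta> c A" "\<pi>' \<in> falsity N ar E B \<rho> \<eta>"
      by (auto simp: realizes_def)
    have "realizes N ar E \<rho> \<eta> (Clo t (c # es) ms) B"
      using ty_lam.prems \<pi> by (intro ty_lam.IH) auto
    then show "good N (Clo (Lam t) es ms) \<pi>" using \<pi> by (auto simp: realizes_def intro: good_Lam)
  qed
next
  case (ty_app \<Gamma> u A B \<Delta> v)
  from ty_app.IH(1)[OF ty_app.prems] ty_app.IH(2)[OF ty_app.prems] show ?case
    by (auto simp: realizes_def intro!: good_App)
next
  case (ty_all1I \<Gamma> t A \<Delta>)
  have "realizes N ar E (case_nat a \<rho>) \<eta> (Clo t es ms) A" if "wf_tm ar a" for a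
    using ty_all1I.prems that
    by (intro ty_all1I.IH) (auto simp: list_all2_map2 realizes_lift1 falsity_lift1 split: nat.split)
  then show ?case by (auto simp: realizes_def)
next
  case (ty_all1E \<Gamma> t A \<Delta> u)
  have "wf_tm ar (sub_tm \<rho> u)" using ty_all1E.hyps(2) ty_all1E.prems(1) by (simp add: wf_tm_sub_tm)
  then have "falsity N ar E (inst1 u A) \<rho> \<eta> \<subseteq> falsity N ar E (All1 A) \<rho> \<eta>"
    unfolding falsity_inst1 falsity.simps(4) by (intro UN_upper CollectI)
  with ty_all1E.IH[OF ty_all1E.prems] show ?case unfolding realizes_def by blast
next
  case (ty_all2I n \<Gamma> t A \<Delta>)
  have "realizes N ar E \<rho> (\<eta>(n := case_nat P (\<eta> n))) (Clo t es ms) A" if "invariant ar E P" for P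
  proof (rule ty_all2I.IH)
    show "\<forall>k X. invariant ar E ((\<eta>(n := case_nat P (\<eta> n))) k X)"
      using ty_all2I.prems that by (auto split: nat.split)
    show "list_all2 (realizes N ar E \<rho> (\<eta>(n := case_nat P (\<eta> n)))) es (map (lift2 n) \<Gamma>)"
      using ty_all2I.prems(3) unfolding list_all2_map2 realizes_def falsity_lift2 .
    show "list_all2 (\<lambda>\<pi> B. \<pi> \<in> falsity N ar E B \<rho> (\<eta>(n := case_nat P (\<eta> n)))) ms (map (lift2 n) \<Delta>)"
      using ty_all2I.prems(4) unfolding list_all2_map2 falsity_lift2 .
  qed (use ty_all2I.prems in auto)
  then show ?case by (auto simp: realizes_def)
next
  case (ty_all2E \<Gamma> t n A \<Delta> G)
  let ?\<rho> = "\<lambda>ts i. if i < n then ts ! i else \<rho> (i - n)"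
  have "falsity N ar E G (?\<rho> ts) \<eta> = falsity N ar E G (?\<rho> us) \<eta>"
    if "list_all2 (eq_conseq ar E) ts us" "length ts = n" for ts us
  proof (rule falsity_eq_conseq)
    show "\<forall>i. eq_conseq ar E (?\<rho> ts i) (?\<rho> us i)"
      using that ty_all2E.prems(1) by (simp add: list_all2_conv_all_nth eq_conseq.eq_refl)
  qed (use ty_all2E.hyps(2) ty_all2E.prems(2) in simp_all)
  then have "invariant ar E (\<lambda>ts. if length ts = n then falsity N ar E G (?\<rho> ts) \<eta> else {})"
    unfolding invariant_def by (auto dest: list_all2_lengthD)
  then have "falsity N ar E (inst2 n G A) \<rho> \<eta> \<subseteq> falsity N ar E (All2 n A) \<rho> \<eta>"
    unfolding falsity_inst2 falsity.simps(5) by (intro UN_upper CollectI)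
  with ty_all2E.IH[OF ty_all2E.prems] show ?case unfolding realizes_def by blast
next
  case (ty_eq \<Gamma> t u A \<Delta> v)
  have "wf_fm ar A"
    using typing_wf[OF E ty_eq.hyps(1)] eq_conseq_wf[OF E ty_eq.hyps(2)] by (simp add: wf_fm_inst1)
  then have "falsity N ar E (inst1 u A) \<rho> \<eta> = falsity N ar E (inst1 v A) \<rho> \<eta>"
    unfolding falsity_inst1 using ty_eq.prems ty_eq.hyps(2)
    by (intro falsity_eq_conseq)
       (auto split: nat.split intro: eq_conseq.eq_refl eq_conseq_sub)
  with ty_eq.IH[OF ty_eq.prems] show ?case by (simp add: realizes_def)
next
  case (ty_mu_other \<Gamma> t A B \<Delta> \<alpha>)
  have "good N (Clo (Mu (Named (Suc \<alpha>) t)) es ms) \<pi>" if "\<pi> \<in> falsity N ar E B \<rho> \<eta>" for \<pi>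
  proof (rule good_Mu)
    have "realizes N ar E \<rho> \<eta> (Clo t es (\<pi> # ms)) A"
      using ty_mu_other.prems that by (intro ty_mu_other.IH) auto
    then show "good N (Clo t es (\<pi> # ms)) ((\<pi> # ms) ! Suc \<alpha>)"
      using ty_mu_other by (auto simp: realizes_def list_all2_conv_all_nth)
    show "Suc \<alpha> < length (\<pi> # ms)"
      using ty_mu_other by (auto simp: list_all2_conv_all_nth)
  qed
  then show ?case by (simp add: realizes_def)
next
  case (ty_mu_same \<Gamma> t B \<Delta>)
  have "good N (Clo (Mu (Named 0 t)) es ms) \<pi>" if "\<pi> \<in> falsity N ar E B \<rho> \<eta>" for \<pi>
  proof (rule good_Mu)
    have "realizes N ar E \<rho> \<eta> (Clo t es (\<pi> # ms)) B"
      using ty_mu_same.prems that by (intro ty_mu_same.IH) auto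
    then show "good N (Clo t es (\<pi> # ms)) ((\<pi> # ms) ! 0)"
      using that by (auto simp: realizes_def)
  qed auto
  then show ?case by (simp add: realizes_def)
qed


lemma funpow_wf_tm:
  "ar sc = 1 \<Longrightarrow> wf_tm ar (((\<lambda>a. Fn sc [a]) ^^ k) a) \<longleftrightarrow> wf_tm ar a"
  by (induction k) auto

lemma eq_conseq_num_inject:
  assumes "adequate ar zr sc E"
  shows "eq_conseq ar E (num_tm zr sc k) (num_tm zr sc n) \<Longrightarrow> k = n"
proof (induction k arbitrary: n)
  case 0
  then show ?case using assms eq_conseq.eq_sym
    by (cases n) (fastforce simp: adequate_def num_tm_def)+
next
  case (Suc k)
  then show ?case using assms
    by (cases n) (auto simp: adequate_def num_tm_def)
qed

text \<open>
  The types say that the constants behave as intended: a counter \<open>k\<close> tests \<open>X(s a)\<close> iff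
  \<open>Suc k\<close> tests \<open>X(a)\<close>, which is the transition of \<open>FC\<close>, and only \<open>n\<close> tests \<open>X(0)\<close>, which is
  where \<open>XC\<close> stops.
\<close>

lemma good_classical_integer:
  assumes "ar zr = 0" and "ar sc = 1"
    and E: "\<forall>(u, v) \<in> E. wf_tm ar u \<and> wf_tm ar v"
    and ad: "adequate ar zr sc E"
    and ty: "typing ar E [] \<theta> (nat_type zr sc (num_tm zr sc n)) []"
  shows "good n (Clo \<theta> [] []) (Push XC (Push FC (SK 0)))"
proof -
  let ?s = "\<lambda>a. Fn sc [a]"
  define P where "P ts = {SK k |k a. ts = [a] \<and> eq_conseq ar E ((?s ^^ k) a) (num_tm zr sc n)}" for ts
  have cong: "eq_conseq ar E ((?s ^^ k) a) ((?s ^^ k) b)" if "eq_conseq ar E a b" for a b k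
    using that assms(2) by (induction k) (auto intro!: eq_conseq.eq_cong)
  have wf_num: "wf_tm ar (num_tm zr sc n)"
    using assms(1,2) by (simp add: num_tm_def funpow_wf_tm)
  have inv: "invariant ar E P"
  proof -
    have "P ts \<subseteq> P us" if "list_all2 (eq_conseq ar E) ts us" for ts us
      using that cong unfolding P_def
      by (auto simp: list_all2_Cons1) (meson eq_conseq.eq_sym eq_conseq.eq_trans)
    moreover have "list_all2 (eq_conseq ar E) us ts" if "list_all2 (eq_conseq ar E) ts us" for ts us
      using that by (auto simp: list_all2_conv_all_nth intro: eq_conseq.eq_sym)
    ultimately show ?thesis unfolding invariant_def by blast
  qed
  let ?\<eta> = "\<lambda>_ _ _. {}"
  let ?\<eta>' = "?\<eta>(1 := case_nat P (?\<eta> 1))"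
  have "realizes n ar E FVar ?\<eta> (Clo \<theta> [] []) (nat_type zr sc (num_tm zr sc n))"
    by (rule adequacy[OF E ty]) (auto simp: invariant_def)
  then have real: "\<pi> \<in> falsity n ar E (Imp (Pred 0 [Fn zr []])
      (Imp (All1 (Imp (Pred 0 [FVar 0]) (Pred 0 [Fn sc [FVar 0]])))
        (Pred 0 [num_tm zr sc n]))) FVar ?\<eta>' \<Longrightarrow> good n (Clo \<theta> [] []) \<pi>" for \<pi>
    using inv unfolding realizes_def nat_type_def falsity.simps(5) by blast
  have num: "sub_tm FVar (num_tm zr sc m) = num_tm zr sc m" for m
    by (induction m) (auto simp: num_tm_def)
  have "good n XC \<pi>" if "\<pi> \<in> P [Fn zr []]" for \<pi>
    using that eq_conseq_num_inject[OF ad, of _ n] by (auto simp: P_def num_tm_def intro: good_XC)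
  moreover have "good n FC (Push c \<pi>)"
    if "\<forall>\<pi>' \<in> P [a]. good n c \<pi>'" and "\<pi> \<in> P [Fn sc [a]]" for a c \<pi>
    using that by (auto simp: P_def simp del: funpow.simps simp add: funpow_Suc_right intro!: good_FC)
  moreover have "SK 0 \<in> P [num_tm zr sc n]"
    using wf_num by (auto simp: P_def intro: eq_conseq.eq_refl)
  ultimately show ?thesis by (intro real) (auto simp: num)
qed


section \<open>The shape of a normal classical integer\<close>

text \<open>Indices 0 and 1 are the variables \<open>f\<close> and \<open>x\<close> of \<open>\<lambda>x\<lambda>f t\<close>.\<close>

primrec body :: "trm \<Rightarrow> bool" and body_c :: "cmd \<Rightarrow> bool" where
  "body (Var i) \<longleftrightarrow> i = 1"
| "body (Lam t) \<longleftrightarrow> False"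
| "body (App t u) \<longleftrightarrow> t = Var 0 \<and> body u"
| "body (Mu c) \<longleftrightarrow> body_c c"
| "body_c (Named \<beta> t) \<longleftrightarrow> body t"

text \<open>
  The counter at the end of the machine run from counter \<open>k\<close>, when \<open>m\<close> gives the counters saved in
  the \<open>\<mu>\<close>-variables. It is meant for terms satisfying \<open>body\<close>; the value at \<open>Lam\<close> and the disregard of
  the function in an application are chosen so that the laws below hold for all terms.
\<close>

primrec val :: "trm \<Rightarrow> (nat \<Rightarrow> nat) \<Rightarrow> nat \<Rightarrow> nat" and val_c :: "cmd \<Rightarrow> (nat \<Rightarrow> nat) \<Rightarrow> nat" where
  "val (Var i) m k = k"
| "val (Lam t) m k = k"
| "val (App t u) m k = val u m (Suc k)"
| "val (Mu c) m k = val_c c (case_nat k m)"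
| "val_c (Named \<beta> t) m = val t m (m \<beta>)"

lemma normal_Lam: "normal (Lam t) \<Longrightarrow> normal t"
  and normal_App1: "normal (App t u) \<Longrightarrow> normal t"
  and normal_App2: "normal (App t u) \<Longrightarrow> normal u"
  and normal_Mu: "normal (Mu (Named \<beta> t)) \<Longrightarrow> normal t"
  unfolding normal_def comp_step_def simp_step_def by (blast intro: ctx_ctx_c.intros)+

lemma normal_App_Lam: "\<not> normal (App (Lam t) u)"
  and normal_App_Mu: "\<not> normal (App (Mu c) u)"
  unfolding normal_def comp_step_def by (blast intro: ctx_ctx_c.intros comp_rule.intros)+

lemma normal_Mu_Mu: "\<not> normal (Mu (Named \<beta> (Mu c)))"
  and normal_Mu_Lam: "\<not> normal (Mu (Named 0 (Lam t)))"
  unfolding normal_def simp_step_def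
   apply (blast intro: ctx_ctx_c.intros simp_rule_c.intros)
  using simp_rule.S3[of "Named 0 (Lam t)"] by (auto intro: ctx_ctx_c.intros)

text \<open>
  The function part of a normal application has a variable at its head, so it runs into one of the
  constants with at least the two given arguments on the stack; neither constant accepts two.
\<close>

lemma not_good_neutral:
  assumes "normal (App t u)" and "set es \<subseteq> {XC, FC}"
  shows "\<not> good N (Clo t es ms) (Push c (Push d \<pi>))"
  using assms
proof (induction t arbitrary: u c d \<pi> rule: trm.induct[where ?P2.0 = "\<lambda>_. True"])
  case (Var i)
  show ?case
  proof
    assume "good N (Clo (Var i) es ms) (Push c (Push d \<pi>))"
    then have "i < length es" "good N (es ! i) (Push c (Push d \<pi>))" by (auto elim: good_Var_E)
    moreover from this(1) have "es ! i = XC \<or> es ! i = FC" using Var.prems(2) by (auto dest: nth_mem)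
    ultimately show False by (auto elim: good_XC_E good_FC_E)
  qed
next
  case (App t1 t2)
  then show ?case by (meson good_App_E normal_App1)
qed (auto simp: normal_App_Lam normal_App_Mu)

text \<open>
  Below the two abstractions all stacks met are counters. An abstraction cannot run on a counter, and
  \<open>f\<close> takes exactly one argument, so only the three forms of \<open>body\<close> can occur.
\<close>

lemma good_body:
  assumes "good N (Clo t [FC, XC] (map SK ms)) (SK k)" and "normal t"
  shows "body t \<and> val t (\<lambda>i. ms ! i) k = N"
  using assms
proof (induction "size t" arbitrary: t ms k rule: less_induct)
  case less
  show ?case
  proof (cases t)
    case (Var i)
    then have "i < 2" "good N ([FC, XC] ! i) (SK k)" using less.prems by (auto elim: good_Var_E)
    then show ?thesis using Var by (auto simp: less_2_cases_iff elim: good_XC_E good_FC_E)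
  next
    case (Lam t')
    then show ?thesis using less.prems by (auto elim: good_Lam_E)
  next
    case (App t' u)
    then have g: "good N (Clo t' [FC, XC] (map SK ms)) (Push (Clo u [FC, XC] (map SK ms)) (SK k))"
      using less.prems by (auto elim: good_App_E)
    have nt: "normal (App t' u)" using less.prems App by simp
    show ?thesis
    proof (cases t')
      case (Var i)
      then have "i < 2" "good N ([FC, XC] ! i) (Push (Clo u [FC, XC] (map SK ms)) (SK k))"
        using g by (auto elim: good_Var_E)
      then have "i = 0" "good N (Clo u [FC, XC] (map SK ms)) (SK (Suc k))"
        by (auto simp: less_2_cases_iff elim: good_XC_E good_FC_E)
      then show ?thesis using less.hyps[of u ms "Suc k"] App Var normal_App2[OF nt] by simp
    next
      case (App t1 t2)
      then have "good N (Clo t1 [FC, XC] (map SK ms))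
          (Push (Clo t2 [FC, XC] (map SK ms)) (Push (Clo u [FC, XC] (map SK ms)) (SK k)))"
        using g by (auto elim: good_App_E)
      then show ?thesis using not_good_neutral[of t1 t2 "[FC, XC]"] nt App normal_App1 by auto
    qed (use nt normal_App_Lam normal_App_Mu in auto)
  next
    case (Mu c)
    then obtain \<beta> u where c: "c = Named \<beta> u" by (cases c)
    then have "\<beta> < length (k # ms)" "good N (Clo u [FC, XC] (map SK (k # ms))) (map SK (k # ms) ! \<beta>)"
      using less.prems Mu by (auto elim!: good_Mu_E)
    then have "good N (Clo u [FC, XC] (map SK (k # ms))) (SK ((k # ms) ! \<beta>))"
      by (metis nth_map)
    then have "body u \<and> val u (\<lambda>i. (k # ms) ! i) ((k # ms) ! \<beta>) = N"
      using less.hyps[of u "k # ms"] less.prems(2) Mu c by (auto dest: normal_Mu)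
    moreover have "(\<lambda>i. (k # ms) ! i) = case_nat k (\<lambda>i. ms ! i)"
      by (rule ext) (auto split: nat.split)
    ultimately show ?thesis using Mu c by (simp add: nth_Cons)
  qed
qed

text \<open>
  While \<open>f\<close> is not yet available, a normal term that runs on an argument is an abstraction: a
  variable or an application would bring \<open>XC\<close> to face an argument, which it does not accept. In \<open>\<mu>\<alpha>[\<beta>]u\<close> the
  only saved stack is the one just captured, so \<open>u\<close> runs on the same argument and \<open>\<beta> = \<alpha>\<close>; then \<open>u\<close>
  would be an abstraction, which \<open>(S\<^sub>3)\<close> excludes, or start with \<open>\<mu>\<close>, which \<open>(S\<^sub>1)\<close> excludes.
\<close>

lemma good_Push_Lam:
  assumes g: "good N (Clo t es []) (Push c \<pi>)" and n: "normal t" and es: "set es \<subseteq> {XC}"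
  obtains u where "t = Lam u" and "good N (Clo u (c # es) []) \<pi>"
proof -
  have no_Var: "\<not> good N (Clo (Var i) es ms) (Push c \<pi>)" for i ms
  proof
    assume "good N (Clo (Var i) es ms) (Push c \<pi>)"
    then have "i < length es" "good N (es ! i) (Push c \<pi>)" by (auto elim: good_Var_E)
    moreover from this(1) have "es ! i = XC" using es by (auto dest: nth_mem)
    ultimately show False by (auto elim: good_XC_E)
  qed
  have no_App: "\<not> good N (Clo (App t1 t2) es ms) (Push c \<pi>)" if "normal (App t1 t2)" for t1 t2 ms
  proof -
    have "set es \<subseteq> {XC, FC}" using es by auto
    from not_good_neutral[OF that this] show ?thesis by (auto elim: good_App_E)
  qed
  show ?thesis
  proof (cases t)
    case (Lam u)
    then show ?thesis using g by (auto elim!: good_Lam_E intro: that)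
  next
    case (Mu d)
    then obtain \<beta> u where d: "d = Named \<beta> u" by (cases d)
    then have "\<beta> = 0" and "good N (Clo u es [Push c \<pi>]) (Push c \<pi>)"
      using g Mu by (auto elim!: good_Mu_E)
    then show ?thesis
      using no_Var no_App n normal_Mu_Mu normal_Mu_Lam normal_Mu[of \<beta> u] Mu d by (cases u) auto
  qed (use g n no_Var no_App in auto)
qed


section \<open>Simplification and cleaning preserve the value\<close>

primrec mus :: "trm \<Rightarrow> nat" and mus_c :: "cmd \<Rightarrow> nat" where
  "mus (Var i) = 0"
| "mus (Lam t) = mus t"
| "mus (App t u) = mus t + mus u"
| "mus (Mu c) = Suc (mus_c c)"
| "mus_c (Named \<beta> t) = mus t"

text \<open>
  The number of applications above the innermost \<open>\<mu>\<close>, for terms whose only branching is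
  the one of \<open>body\<close>.
\<close>

primrec above :: "trm \<Rightarrow> nat" and above_c :: "cmd \<Rightarrow> nat" where
  "above (Var i) = 0"
| "above (Lam t) = 0"
| "above (App t u) = (if mus u = 0 then 0 else Suc (above u))"
| "above (Mu c) = above_c c"
| "above_c (Named \<beta> t) = above t"

lemma case_nat_up: "case_nat k m (up r i) = case_nat k (\<lambda>j. m (r j)) i"
  by (cases i) auto

lemma val_ren: "val (ren r q t) m k = val t (\<lambda>i. m (q i)) k"
  and val_ren_c: "val_c (ren_c r q c) m = val_c c (\<lambda>i. m (q i))"
  by (induction t and c arbitrary: r q m k and r q m) (simp_all add: case_nat_up)

lemma val_cong: "(\<And>i. i \<in> fv_mu t \<Longrightarrow> m i = m' i) \<Longrightarrow> val t m k = val t m' k"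
  and val_cong_c: "(\<And>i. i \<in> fv_mu_c c \<Longrightarrow> m i = m' i) \<Longrightarrow> val_c c m = val_c c m'"
proof (induction t and c arbitrary: m m' k and m m')
  case (Lam t)
  show ?case by simp
next
  case (App t u)
  show ?case by (simp, rule App.IH(2)) (simp add: App.prems)
next
  case (Mu c)
  have "case_nat k m i = case_nat k m' i" if "i \<in> fv_mu_c c" for i
    using that by (cases i) (simp_all add: Mu.prems)
  then show ?case by (simp, intro Mu.IH)
next
  case (Named \<beta> t)
  have "m \<beta> = m' \<beta>" by (simp add: Named.prems)
  then show ?case by (simp, intro Named.IH) (simp add: Named.prems)
qed simp

lemma body_ren: "body (ren id q t) \<longleftrightarrow> body t"
  and body_ren_c: "body_c (ren_c id q c) \<longleftrightarrow> body_c c"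
proof (induction t and c arbitrary: q and q)
  case (App t u)
  then show ?case by (cases t) auto
qed auto

lemma mus_ren: "mus (ren r q t) = mus t"
  and mus_ren_c: "mus_c (ren_c r q c) = mus_c c"
  by (induction t and c arbitrary: r q and r q) auto

lemma fv_mu_ren: "fv_mu (ren r q t) = q ` fv_mu t"
  and fv_mu_ren_c: "fv_mu_c (ren_c r q c) = q ` fv_mu_c c"
proof (induction t and c arbitrary: r q and r q)
  case (Mu c)
  have "Suc a \<in> up q ` S \<longleftrightarrow> (\<exists>i. Suc i \<in> S \<and> a = q i)" for a S
  proof
    assume "Suc a \<in> up q ` S"
    then obtain j where "j \<in> S" "Suc a = up q j" by blast
    then show "\<exists>i. Suc i \<in> S \<and> a = q i" by (cases j) auto
  qed (auto intro: image_eqI[where x = "Suc i" for i])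
  then show ?case using Mu.IH by auto
qed auto

lemma names_lam_body: "body t \<Longrightarrow> \<not> names_lam \<alpha> t"
  and names_lam_body_c: "body_c c \<Longrightarrow> \<not> names_lam_c \<alpha> c"
  by (induction t and c arbitrary: \<alpha> and \<alpha>) auto

text \<open>
  Without abstractions \<open>(S\<^sub>3)\<close> cannot fire. The other two rules rename names, and the renamed command
  looks up the same counters: in \<open>(S\<^sub>1)\<close> the inner \<open>\<mu>\<close>-variable saves exactly the counter of the name
  in front of it.
\<close>

lemma simp_step_body:
  "ctx simp_rule simp_rule_c t u \<Longrightarrow> body t \<Longrightarrow>
     body u \<and> mus u < mus t \<and> fv_mu u \<subseteq> fv_mu t \<and> (\<forall>m k. val u m k = val t m k)"
  "ctx_c simp_rule simp_rule_c c d \<Longrightarrow> body_c c \<Longrightarrow>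
     body_c d \<and> mus_c d < mus_c c \<and> fv_mu_c d \<subseteq> fv_mu_c c \<and> (\<forall>m. val_c d m = val_c c m)"
proof (induction rule: ctx_ctx_c.inducts)
  case (root t u)
  from root(1) show ?case
  proof cases
    case (S2 w)
    have "val w (\<lambda>i. m (i - 1)) k = val w (case_nat k m) k" for m k
      by (rule val_cong) (use S2 in \<open>auto split: nat.split\<close>)
    moreover have "(\<lambda>i. i - 1) ` fv_mu w \<subseteq> {i. Suc i \<in> fv_mu w}"
    proof clarify
      fix i assume "i \<in> fv_mu w"
      then show "Suc (i - 1) \<in> fv_mu w" using S2(3) by (cases i) auto
    qed
    ultimately show ?thesis
      using root(2) unfolding S2(1,2) by (simp add: val_ren body_ren mus_ren fv_mu_ren)
  next
    case (S3 c)
    then show ?thesis using root(2) names_lam_body_c by auto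
  qed
next
  case (root_c c d)
  from root_c(1) show ?case
  proof cases
    case (S1 \<alpha> b)
    have m: "(\<lambda>i. m (case_nat \<alpha> id i)) = case_nat (m \<alpha>) m" for m :: "nat \<Rightarrow> nat"
      by (rule ext) (simp split: nat.split)
    have "val_c d m = val_c c m" for m
      unfolding S1 val_ren_c m by simp
    moreover have "fv_mu_c d \<subseteq> fv_mu_c c"
      unfolding S1 fv_mu_ren_c by (auto split: nat.splits)
    moreover have "body_c d" "mus_c d < mus_c c"
      using root_c(2) unfolding S1 by (simp_all add: body_ren_c mus_ren_c)
    ultimately show ?thesis by blast
  qed
next
  case (AppL t u v)
  then show ?case by (auto elim: ctx.cases simp_rule.cases)
qed auto

lemma simp_step_LamD:
  assumes "simp_step (Lam t) v"
  obtains u where "v = Lam u" and "simp_step t u"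
  using assms unfolding simp_step_def by cases (auto elim: simp_rule.cases)

lemma simp_step_Lam: "simp_step t u \<Longrightarrow> simp_step (Lam t) (Lam u)"
  unfolding simp_step_def by (rule ctx_ctx_c.Lam)

lemma clean_step_Lam: "clean_step t u \<Longrightarrow> clean_step (Lam t) (Lam u)"
  unfolding clean_step_def by (rule ctx_ctx_c.Lam)

lemma simp_steps_Lam: "simp_step\<^sup>*\<^sup>* t u \<Longrightarrow> simp_step\<^sup>*\<^sup>* (Lam t) (Lam u)"
  by (induction rule: rtranclp_induct) (auto intro: simp_step_Lam rtranclp.rtrancl_into_rtrancl)

lemma simp_normalize:
  assumes "body t"
  shows "\<exists>u. simp_step\<^sup>*\<^sup>* t u \<and> \<not> (\<exists>v. simp_step u v) \<and> body u \<and> fv_mu u \<subseteq> fv_mu t \<and>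
    (\<forall>m k. val u m k = val t m k) \<and> (u = t \<or> mus u < mus t)"
  using assms
proof (induction "mus t" arbitrary: t rule: less_induct)
  case less
  show ?case
  proof (cases "\<exists>v. simp_step t v")
    case True
    then obtain v where v: "simp_step t v" by blast
    then have inv: "body v \<and> mus v < mus t \<and> fv_mu v \<subseteq> fv_mu t \<and> (\<forall>m k. val v m k = val t m k)"
      unfolding simp_step_def using simp_step_body(1) less.prems by blast
    then obtain u where "simp_step\<^sup>*\<^sup>* v u" "\<not> (\<exists>v. simp_step u v)" "body u" "fv_mu u \<subseteq> fv_mu v"
      "\<forall>m k. val u m k = val v m k" "u = v \<or> mus u < mus v"
      using less.hyps[of v] by blast
    then show ?thesis using v inv by (intro exI[of _ u]) (auto intro: converse_rtranclp_into_rtranclp)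
  next
    case False
    then show ?thesis using less.prems by blast
  qed
qed

lemma body_sub_left: "body t \<Longrightarrow> body (sub_left \<alpha> (Var 0) t)"
  and body_sub_left_c: "body_c c \<Longrightarrow> body_c (sub_left_c \<alpha> (Var 0) c)"
  by (induction t and c arbitrary: \<alpha> and \<alpha>) auto

lemma mus_sub_left: "mus v = 0 \<Longrightarrow> mus (sub_left \<alpha> v t) = mus t"
  and mus_sub_left_c: "mus v = 0 \<Longrightarrow> mus_c (sub_left_c \<alpha> v c) = mus_c c"
  by (induction t and c arbitrary: \<alpha> v and \<alpha> v) (auto simp: mus_ren)

lemma fv_mu_sub_left: "fv_mu v = {} \<Longrightarrow> fv_mu (sub_left \<alpha> v t) = fv_mu t"
  and fv_mu_sub_left_c: "fv_mu v = {} \<Longrightarrow> fv_mu_c (sub_left_c \<alpha> v c) = fv_mu_c c"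
  by (induction t and c arbitrary: \<alpha> v and \<alpha> v) (auto simp: fv_mu_ren)

text \<open>
  Jumping to \<open>\<alpha>\<close> through one more \<open>f\<close> has the same effect as having saved a counter larger by
  one. This makes \<open>(N)\<close> sound, since an \<open>f\<close> outside a \<open>\<mu>\<close> increments the counter that the
  \<open>\<mu>\<close> saves.
\<close>

lemma val_sub_left: "val (sub_left \<alpha> v t) m k = val t (m(\<alpha> := Suc (m \<alpha>))) k"
  and val_sub_left_c: "val_c (sub_left_c \<alpha> v c) m = val_c c (m(\<alpha> := Suc (m \<alpha>)))"
proof (induction t and c arbitrary: \<alpha> v m k and \<alpha> v m)
  case (Mu c)
  have "(case_nat k m)(Suc \<alpha> := Suc (m \<alpha>)) = case_nat k (m(\<alpha> := Suc (m \<alpha>)))"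
    by (rule ext) (auto split: nat.split)
  then show ?case by (simp only: sub_left.simps val.simps Mu.IH nat.case)
qed auto

lemma above_mus_0: "mus t = 0 \<Longrightarrow> above t = 0"
  by (cases t) auto

text \<open>
  The innermost \<open>\<mu>\<close> is either under an \<open>f\<close>, where \<open>(N)\<close> applies, or directly under a name, where
  \<open>(S\<^sub>1)\<close> would apply, or at the top. Choosing the innermost one matters: the copies of \<open>f\<close> that
  \<open>(N)\<close> creates land below it, where \<open>above\<close> does not count them.
\<close>

lemma clean_progress:
  assumes "body t" and "mus t > 0" and "\<not> (\<exists>v. simp_step t v)"
  shows "(\<exists>u. clean_step t u \<and> body u \<and> mus u = mus t \<and> above u < above t \<and> fv_mu u = fv_mu t \<and>
             (\<forall>m k. val u m k = val t m k))
       \<or> (\<exists>\<beta> w. t = Mu (Named \<beta> w) \<and> mus w = 0)"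
  using assms
proof (induction "size t" arbitrary: t rule: less_induct)
  case less
  show ?case
  proof (cases t)
    case (App s u)
    then have s: "s = Var 0" and u: "body u" "mus u > 0" using less.prems by auto
    have "\<not> (\<exists>v. simp_step u v)"
      using less.prems(3) App unfolding simp_step_def by (blast intro: ctx_ctx_c.intros)
    from less.hyps[OF _ u this] App consider
        (step) u' where "clean_step u u'" "body u'" "mus u' = mus u" "above u' < above u"
          "fv_mu u' = fv_mu u" "\<forall>m k. val u' m k = val u m k"
      | (Mu) \<beta> w where "u = Mu (Named \<beta> w)" "mus w = 0"
      by auto
    then show ?thesis
    proof cases
      case step
      then have "clean_step t (App s u')" unfolding App clean_step_def by (blast intro: ctx_ctx_c.AppR)
      then show ?thesis using step App s u by (intro disjI1 exI[of _ "App s u'"]) auto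
    next
      case Mu
      let ?v = "Mu (sub_left_c 0 (Var 0) (Named \<beta> w))"
      have "clean_step t ?v"
        using ctx_ctx_c.root[of clean_rule, OF clean_rule.N[of "Var 0" "Named \<beta> w"]]
        unfolding App clean_step_def s Mu by simp
      moreover have "(case_nat k m)(0 := Suc k) = case_nat (Suc k) m" for k and m :: "nat \<Rightarrow> nat"
        by (rule ext) (auto split: nat.split)
      then have "val ?v m k = val t m k" for m k
        unfolding val.simps(4) val_sub_left_c by (simp add: App Mu)
      moreover have "fv_mu ?v = fv_mu t"
        using fv_mu_sub_left_c[of "Var 0" 0 "Named \<beta> w"] App Mu s by simp
      moreover have "body ?v" using body_sub_left_c[of "Named \<beta> w"] u Mu by simp
      moreover have "mus ?v = mus t"
        using mus_sub_left_c[of "Var 0" 0 "Named \<beta> w"] App Mu s by simp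
      moreover have "above ?v = 0"
        using Mu mus_sub_left[of "Var 0" 0 w] by (auto simp: above_mus_0)
      ultimately show ?thesis using App Mu by (intro disjI1 exI[of _ ?v]) auto
    qed
  next
    case (Mu c)
    obtain \<beta> w where c: "c = Named \<beta> w" by (cases c)
    show ?thesis
    proof (cases "mus w = 0")
      case True
      then show ?thesis using Mu c by blast
    next
      case False
      have w: "body w" "mus w > 0" using False less.prems Mu c by auto
      have "\<not> (\<exists>v. simp_step w v)"
        using less.prems(3) Mu c unfolding simp_step_def by (blast intro: ctx_ctx_c.intros)
      from less.hyps[OF _ w this] Mu c consider
          (step) w' where "clean_step w w'" "body w'" "mus w' = mus w" "above w' < above w"
            "fv_mu w' = fv_mu w" "\<forall>m k. val w' m k = val w m k"
        | (Mu_Mu) d where "w = Mu d"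
        by auto
      then show ?thesis
      proof cases
        case step
        then have "clean_step t (Mu (Named \<beta> w'))"
          unfolding Mu c clean_step_def by (blast intro: ctx_ctx_c.intros)
        then show ?thesis using step Mu c by (intro disjI1 exI[of _ "Mu (Named \<beta> w')"]) auto
      next
        case Mu_Mu
        then have False using less.prems(3) Mu c unfolding simp_step_def
          by (blast intro: ctx_ctx_c.intros simp_rule_c.intros)
        then show ?thesis ..
      qed
    qed
  qed (use less.prems in auto)
qed

lemma fv_mu_mus_0: "mus t = 0 \<Longrightarrow> fv_mu t = {}"
  by (induction t rule: trm.induct[where ?P2.0 = "\<lambda>_. True"]) auto

lemma body_mus_0: "body t \<Longrightarrow> mus t = 0 \<Longrightarrow> \<exists>j. t = (App (Var 0) ^^ j) (Var 1) \<and> val t m k = j + k"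
proof (induction t arbitrary: k rule: trm.induct[where ?P2.0 = "\<lambda>_. True"])
  case (Var i)
  then show ?case by (intro exI[of _ 0]) auto
next
  case (App t u)
  then obtain j where "u = (App (Var 0) ^^ j) (Var 1)" "val u m (Suc k) = j + Suc k"
    using App.IH(2)[of "Suc k"] by force
  then show ?case using App by (intro exI[of _ "Suc j"]) auto
qed auto

text \<open>
  Termination of cleaning followed by simplification, by the lexicographic order on the number of \<open>\<mu>\<close>s
  and the position of the innermost one.
\<close>

lemma hook_church:
  assumes "body t" and "fv_mu t = {}" and "\<not> (\<exists>v. simp_step t v)" and "val t m 0 = n"
  shows "Lam (Lam t) \<hookrightarrow> church n"
  using assms
proof (induction "(mus t, above t)" arbitrary: t rule: wf_induct_rule[OF wf_lex_prod[OF wf_less_than wf_less_than]])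
  case (1 t)
  show ?case
  proof (cases "mus t = 0")
    case True
    then obtain j where "t = (App (Var 0) ^^ j) (Var 1)" "val t m 0 = j + 0"
      using body_mus_0 1(2) by blast
    then show ?thesis using 1 by (auto simp: church_def hook_def)
  next
    case False
    have "t \<noteq> Mu (Named \<beta> w)" if "mus w = 0" for \<beta> w
    proof
      assume t: "t = Mu (Named \<beta> w)"
      then have "\<beta> = 0" using 1(3) by (cases \<beta>) auto
      then have "simp_step t (ren id (\<lambda>\<alpha>. \<alpha> - 1) w)"
        using t ctx_ctx_c.root[of simp_rule, OF simp_rule.S2[of w]] fv_mu_mus_0[OF that]
        unfolding simp_step_def by simp
      then show False using 1(4) by blast
    qed
    then obtain u where u: "clean_step t u" "body u" "mus u = mus t" "above u < above t"
        "fv_mu u = fv_mu t" "\<forall>m k. val u m k = val t m k"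
      using clean_progress[OF 1(2)] False 1(4) by auto
    obtain v where v: "simp_step\<^sup>*\<^sup>* u v" "\<not> (\<exists>v'. simp_step v v')" "body v" "fv_mu v \<subseteq> fv_mu u"
        "\<forall>m k. val v m k = val u m k" "v = u \<or> mus v < mus u"
      using simp_normalize[OF u(2)] by blast
    have "hook_step (Lam (Lam t)) (Lam (Lam v))"
      unfolding hook_step_def using u(1) v(1,2)
      by (auto intro!: exI[of _ "Lam (Lam u)"] clean_step_Lam simp_steps_Lam elim!: simp_step_LamD)
    moreover have "Lam (Lam v) \<hookrightarrow> church n"
      using u v 1(3,5) by (intro 1(1)) auto
    ultimately show ?thesis unfolding hook_def by (rule converse_rtranclp_into_rtranclp)
  qed
qed

theorem mainTheorem2:
  fixes ar :: "'f \<Rightarrow> nat" and zr sc :: 'f and E :: "('f tm \<times> 'f tm) set"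
    and \<theta> :: trm and n :: nat
  assumes "ar zr = 0" and "ar sc = 1"
    and "\<forall>(u, v) \<in> E. wf_tm ar u \<and> wf_tm ar v"
    and "adequate ar zr sc E"
    and "classical_integer ar zr sc E n \<theta>" and "normal \<theta>"
  shows "\<theta> \<hookrightarrow> church n"
proof -
  have "typing ar E [] \<theta> (nat_type zr sc (num_tm zr sc n)) []" and closed: "closed \<theta>"
    using assms(5) by (auto simp: classical_integer_def)
  from good_classical_integer[OF assms(1-4) this(1)]
  have "good n (Clo \<theta> [] []) (Push XC (Push FC (SK 0)))" .
  then obtain u where u: "\<theta> = Lam u" "good n (Clo u [XC] []) (Push FC (SK 0))"
    using assms(6) by (auto elim: good_Push_Lam)
  moreover have "normal u" using assms(6) u(1) normal_Lam by blast
  ultimately obtain t where t: "u = Lam t" "good n (Clo t [FC, XC] []) (SK 0)"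
    by (auto elim: good_Push_Lam)
  have "normal t" using \<open>normal u\<close> t(1) normal_Lam by blast
  with good_body[of n t "[]" 0] t(2) have "body t" "val t (\<lambda>i. [] ! i) 0 = n" by auto
  moreover have "fv_mu t = {}" using closed u(1) t(1) by (simp add: closed_def)
  moreover have "\<not> (\<exists>v. simp_step t v)" using \<open>normal t\<close> by (auto simp: normal_def)
  ultimately show ?thesis unfolding u(1) t(1) by (intro hook_church)
qed

end
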